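(* Let $\Phi=\{\varphi_1,\dots,\varphi_n\}$ be a finite set of $\mathrm{LTL}_f$ properties over $\mathcal{X}\cup\mathcal{Y}$ with multi-property arena $\mathcal{G}^\times=(2^{\mathcal{X}\cup\mathcal{Y}},S^\times,s_0^\times,\delta^\times)$ and multi-property winning relation $\mathrm{WinM}\subseteq S^\times\times 2^\Phi$. Let $C\subseteq\Phi$ with $(s_0^\times,C)\in\mathrm{WinM}$. Then an extracted transducer $T_C$ for $C$ exists, and it implements a winning strategy for realizing $C$: for every input sequence $\xi\in(2^{\mathcal{X}})^\omega$, the play induced by $T_C$ on $\xi$ reaches a state $s\in S^\times$ with $s\models C$ after finitely many steps (where it terminates), and the generated finite trace satisfies every $\varphi_i\in C$.
   Context: Setting. The finite set of atomic propositions $\mathsf{AP}=\mathcal{X}\cup\mathcal{Y}$ is partitioned into disjoint sets $\mathcal{X}$ (inputs, controlled by the environment) and $\mathcal{Y}$ (outputs, controlled by the agent). $\mathrm{LTL}_f$ formulas: $\varphi::=\mathrm{true}\mid a\in\mathsf{AP}\mid\neg\varphi\mid\varphi\wedge\varphi\mid \mathsf{X}\varphi\mid\varphi\,\mathsf{U}\,\varphi$. They are interpreted over finite traces $\rho=\rho[0]\cdots\rho[m]$ with $\rho[i]\in 2^{\mathsf{AP}}$ and $|\rho|=m+1$ (so traces are nonempty): Boolean cases as usual; $\rho,i\models a$ iff $a\in\rho[i]$; $\rho,i\models\mathsf{X}\varphi$ iff $i+1<|\rho|$ and $\rho,i+1\models\varphi$; $\rho,i\models\varphi_1\mathsf{U}\varphi_2$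 iff there is $j$ with $i\le j<|\rho|$, $\rho,j\models\varphi_2$, and $\rho,k\models\varphi_1$ for all $i\le k<j$. $\rho\models\varphi$ iff $\rho,0\models\varphi$. For each $\varphi_i\in\Phi$, let $\mathcal{G}_i=(2^{\mathcal{X}\cup\mathcal{Y}},S_i,q_i^0,\delta_i,F_i)$ be a (complete) deterministic finite automaton whose language is exactly the set of finite traces satisfying $\varphi_i$ (in particular the empty word, not being a trace, is not accepted). The multi-property arena is the product $\mathcal{G}^\times=(2^{\mathcal{X}\cup\mathcal{Y}},S^\times,s_0^\times,\delta^\times)$ with $S^\times=S_1\times\cdots\times S_n$, $s_0^\times=(q_1^0,\dots,q_n^0)$, $\delta^\times((q_1,\dots,q_n),a)=(\delta_1(q_1,a),\dots,\delta_n(q_n,a))$. For $s=(q_1,\dots,q_n)\in S^\times$ and $C\subseteq\Phi$: $s\models C$ iff $q_i\in F_i$ for every $\varphi_i\in C$. For $\mathcal{E}\subseteq S^\times\times 2^{\Phi}$ let $\mathrm{PreMC}(\mathcal{E}):=\{(s,C)\mid \exists Y\in 2^{\mathcal{Y}}\ \forall X\in 2^{\mathcal{X}}.\ (\delta^\times(s,Y\cup X),C)\in\mathcal{E}\}$. Set $\mathrm{WinM}_0:=\{(s,C)\mid s\models C\}$, $\mathrm{WinM}_{i+1}:=\mathrm{WinM}_i\cup\mathrm{PreMC}(\mathrm{WinM}_i)$, $\mathrm{WinM}:=\bigcup_{i\ge0}\mathrm{WinM}_i$. For $C\subseteq\Phi$ let $\mathrm{WinM}_i|_C:=\{s\in S^\times\mid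 (s,C)\in\mathrm{WinM}_i\}$ and $\mathrm{WinM}|_C:=\{s\in S^\times\mid(s,C)\in\mathrm{WinM}\}$. Extracted transducer for $C$ (when $(s_0^\times,C)\in\mathrm{WinM}$): a transducer $T_C=(2^{\mathcal{X}\cup\mathcal{Y}},Q,q_0,\eta,\omega_C)$ with state set $Q=\mathrm{WinM}|_C$, initial state $q_0=s_0^\times$, and output function $\omega_C$ on $Q$ such that: (1) for $s\in\mathrm{WinM}_0|_C$ (i.e. $s\models C$), $\omega_C(s)$ is a designated action "done", upon which the play terminates; (2) for each $i>0$ and each $s\in\mathrm{WinM}_i|_C\setminus\mathrm{WinM}_{i-1}|_C$, $\omega_C(s)\in 2^{\mathcal{Y}}$ and $\delta^\times(s,\omega_C(s)\cup X)\in\mathrm{WinM}_{i-1}|_C$ for all $X\in 2^{\mathcal{X}}$. The transition function is $\eta(q,X):=\delta^\times(q,\omega_C(q)\cup X)$ for states $q$ with $\omega_C(q)\ne$ "done". On input $\xi=X_0X_1\cdots$ the induced play is $q_0=s_0^\times$, $q_{t+1}=\eta(q_t,X_t)$, continued until a state $q_k$ with output "done" is reached; the generated finite trace is then the word $(\omega_C(q_0)\cup X_0)\cdots(\omega_C(q_{k-1})\cup X_{k-1})$. The theorem asserts that at least one such $\omega_C$ exists and that any transducer obtained this way has the stated property. *)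

theory Defs
  imports "HOL-Library.FuncSet"
begin

datatype (atoms: 'a) ltlf =
    TrueF
  | Atom 'a
  | Neg "'a ltlf"
  | Conj "'a ltlf" "'a ltlf"
  | Next "'a ltlf"
  | Until "'a ltlf" "'a ltlf"

definition finite_traces :: "'a set \<Rightarrow> 'a set list set" where
  "finite_traces AP = {\<rho> \<in> lists (Pow AP). \<rho> \<noteq> []}"

primrec holds_at :: "'a set list \<Rightarrow> nat \<Rightarrow> 'a ltlf \<Rightarrow> bool" where
  "holds_at \<rho> i TrueF \<longleftrightarrow> True"
| "holds_at \<rho> i (Atom a) \<longleftrightarrow> a \<in> \<rho> ! i"
| "holds_at \<rho> i (Neg f) \<longleftrightarrow> \<not> holds_at \<rho> i f"
| "holds_at \<rho> i (Conj f g) \<longleftrightarrow> holds_at \<rho> i f \<and> holds_at \<rho> i g"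
| "holds_at \<rho> i (Next f) \<longleftrightarrow> i + 1 < length \<rho> \<and> holds_at \<rho> (i + 1) f"
| "holds_at \<rho> i (Until f g) \<longleftrightarrow>
     (\<exists>j. i \<le> j \<and> j < length \<rho> \<and> holds_at \<rho> j g \<and> (\<forall>k. i \<le> k \<and> k < j \<longrightarrow> holds_at \<rho> k f))"

text \<open>Only meaningful for nonempty words; it is always used together with \<^const>\<open>finite_traces\<close>.\<close>

definition satisfies :: "'a set list \<Rightarrow> 'a ltlf \<Rightarrow> bool" where
  "satisfies \<rho> f \<longleftrightarrow> holds_at \<rho> 0 f"

record ('q, 'l) arena =
  alphabet :: "'l set"
  states :: "'q set"
  init :: 'q
  delta :: "'q \<Rightarrow> 'l \<Rightarrow> 'q"

record ('q, 'l) dfa = "('q, 'l) arena" +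
  final :: "'q set"

definition is_dfa :: "('q, 'l) dfa \<Rightarrow> bool" where
  "is_dfa A \<longleftrightarrow> finite (alphabet A) \<and> finite (states A) \<and> init A \<in> states A \<and>
     (\<forall>q \<in> states A. \<forall>a \<in> alphabet A. delta A q a \<in> states A) \<and> final A \<subseteq> states A"

definition language :: "('q, 'l) dfa \<Rightarrow> 'l list set" where
  "language A = {w \<in> lists (alphabet A). foldl (delta A) (init A) w \<in> final A}"

text \<open>
  The properties are a family indexed by \<open>{1..n}\<close>, and \<open>G i\<close> is the automaton of the \<open>i\<close>-th one.
  A tuple of states is an extensional function on \<open>{1..n}\<close>.
\<close>

definition product_arena ::
  "'a set \<Rightarrow> 'a set \<Rightarrow> nat \<Rightarrow> (nat \<Rightarrow> ('q, 'a set) dfa) \<Rightarrow> (nat \<Rightarrow> 'q, 'a set) arena" where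
  "product_arena X Y n G =
    \<lparr> alphabet = Pow (X \<union> Y),
      states = (\<Pi>\<^sub>E i\<in>{1..n}. states (G i)),
      init = (\<lambda>i\<in>{1..n}. init (G i)),
      delta = (\<lambda>s a. \<lambda>i\<in>{1..n}. delta (G i) (s i) a) \<rparr>"

definition state_models ::
  "nat \<Rightarrow> (nat \<Rightarrow> 'a ltlf) \<Rightarrow> (nat \<Rightarrow> ('q, 'a set) dfa) \<Rightarrow> (nat \<Rightarrow> 'q) \<Rightarrow> 'a ltlf set \<Rightarrow> bool" where
  "state_models n phi G s C \<longleftrightarrow> (\<forall>i\<in>{1..n}. phi i \<in> C \<longrightarrow> s i \<in> final (G i))"

definition PreMC ::
  "'a set \<Rightarrow> 'a set \<Rightarrow> nat \<Rightarrow> (nat \<Rightarrow> 'a ltlf) \<Rightarrow> (nat \<Rightarrow> ('q, 'a set) dfa) \<Rightarrow>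
   ((nat \<Rightarrow> 'q) \<times> 'a ltlf set) set \<Rightarrow> ((nat \<Rightarrow> 'q) \<times> 'a ltlf set) set" where
  "PreMC X Y n phi G E =
    {(s, C). s \<in> states (product_arena X Y n G) \<and> C \<subseteq> phi ` {1..n} \<and>
       (\<exists>U\<in>Pow Y. \<forall>V\<in>Pow X. (delta (product_arena X Y n G) s (U \<union> V), C) \<in> E)}"

primrec WinM_level ::
  "'a set \<Rightarrow> 'a set \<Rightarrow> nat \<Rightarrow> (nat \<Rightarrow> 'a ltlf) \<Rightarrow> (nat \<Rightarrow> ('q, 'a set) dfa) \<Rightarrow> nat \<Rightarrow>
   ((nat \<Rightarrow> 'q) \<times> 'a ltlf set) set" where
  "WinM_level X Y n phi G 0 =
    {(s, C). s \<in> states (product_arena X Y n G) \<and> C \<subseteq> phi ` {1..n} \<and> state_models n phi G s C}"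
| "WinM_level X Y n phi G (Suc i) =
    WinM_level X Y n phi G i \<union> PreMC X Y n phi G (WinM_level X Y n phi G i)"

definition WinM ::
  "'a set \<Rightarrow> 'a set \<Rightarrow> nat \<Rightarrow> (nat \<Rightarrow> 'a ltlf) \<Rightarrow> (nat \<Rightarrow> ('q, 'a set) dfa) \<Rightarrow>
   ((nat \<Rightarrow> 'q) \<times> 'a ltlf set) set" where
  "WinM X Y n phi G = (\<Union>i. WinM_level X Y n phi G i)"

definition restrict_to :: "('s \<times> 'c) set \<Rightarrow> 'c \<Rightarrow> 's set" where
  "restrict_to W C = {s. (s, C) \<in> W}"

datatype 'a action = Done | Act (act: "'a set")

record ('s, 'a) transducer =
  t_alphabet :: "'a set set"
  t_states :: "'s set"
  t_init :: 's
  t_next :: "'s \<Rightarrow> 'a set \<Rightarrow> 's"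
  t_out :: "'s \<Rightarrow> 'a action"

text \<open>
  \<^const>\<open>t_next\<close> is a total function in HOL, but only its values at states whose output is not
  \<^const>\<open>Done\<close> and at inputs from \<open>Pow X\<close> are constrained; plays never use the other ones.
\<close>

definition is_transducer :: "'a set \<Rightarrow> 'a set \<Rightarrow> ('s, 'a) transducer \<Rightarrow> bool" where
  "is_transducer X Y T \<longleftrightarrow>
     t_alphabet T = Pow (X \<union> Y) \<and> finite (t_states T) \<and> t_init T \<in> t_states T \<and>
     (\<forall>q \<in> t_states T. t_out T q \<in> insert Done (Act ` Pow Y)) \<and>
     (\<forall>q \<in> t_states T. t_out T q \<noteq> Done \<longrightarrow> (\<forall>V\<in>Pow X. t_next T q V \<in> t_states T))"

definition extracted_transducer ::
  "'a set \<Rightarrow> 'a set \<Rightarrow> nat \<Rightarrow> (nat \<Rightarrow> 'a ltlf) \<Rightarrow> (nat \<Rightarrow> ('q, 'a set) dfa) \<Rightarrow> 'a ltlf set \<Rightarrow>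
   (nat \<Rightarrow> 'q, 'a) transducer \<Rightarrow> bool" where
  "extracted_transducer X Y n phi G C T \<longleftrightarrow>
     is_transducer X Y T \<and>
     t_states T = restrict_to (WinM X Y n phi G) C \<and>
     t_init T = init (product_arena X Y n G) \<and>
     (\<forall>s \<in> restrict_to (WinM_level X Y n phi G 0) C. t_out T s = Done) \<and>
     (\<forall>i > 0. \<forall>s \<in> restrict_to (WinM_level X Y n phi G i) C
                    - restrict_to (WinM_level X Y n phi G (i - 1)) C.
        \<exists>U\<in>Pow Y. t_out T s = Act U \<and>
          (\<forall>V\<in>Pow X. delta (product_arena X Y n G) s (U \<union> V)
                       \<in> restrict_to (WinM_level X Y n phi G (i - 1)) C)) \<and>
     (\<forall>s \<in> t_states T. t_out T s \<noteq> Done \<longrightarrow>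
        (\<forall>V\<in>Pow X. t_next T s V = delta (product_arena X Y n G) s (act (t_out T s) \<union> V)))"

primrec play :: "('s, 'a) transducer \<Rightarrow> (nat \<Rightarrow> 'a set) \<Rightarrow> nat \<Rightarrow> 's" where
  "play T \<xi> 0 = t_init T"
| "play T \<xi> (Suc t) = t_next T (play T \<xi> t) (\<xi> t)"

text \<open>\<^const>\<open>play\<close> is relevant only up to the first state with output \<^const>\<open>Done\<close>.\<close>

definition terminates_at :: "('s, 'a) transducer \<Rightarrow> (nat \<Rightarrow> 'a set) \<Rightarrow> nat \<Rightarrow> bool" where
  "terminates_at T \<xi> k \<longleftrightarrow>
     t_out T (play T \<xi> k) = Done \<and> (\<forall>t<k. t_out T (play T \<xi> t) \<noteq> Done)"

definition generated_trace :: "('s, 'a) transducer \<Rightarrow> (nat \<Rightarrow> 'a set) \<Rightarrow> nat \<Rightarrow> 'a set list" where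
  "generated_trace T \<xi> k = map (\<lambda>t. act (t_out T (play T \<xi> t)) \<union> \<xi> t) [0..<k]"

definition implements_winning_strategy ::
  "'a set \<Rightarrow> 'a set \<Rightarrow> nat \<Rightarrow> (nat \<Rightarrow> 'a ltlf) \<Rightarrow> (nat \<Rightarrow> ('q, 'a set) dfa) \<Rightarrow> 'a ltlf set \<Rightarrow>
   (nat \<Rightarrow> 'q, 'a) transducer \<Rightarrow> bool" where
  "implements_winning_strategy X Y n phi G C T \<longleftrightarrow>
     (\<forall>\<xi>. (\<forall>t. \<xi> t \<in> Pow X) \<longrightarrow>
       (\<exists>k. terminates_at T \<xi> k \<and>
            (\<forall>t\<le>k. play T \<xi> t \<in> t_states T) \<and>
            play T \<xi> k \<in> states (product_arena X Y n G) \<and>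
            state_models n phi G (play T \<xi> k) C \<and>
            (\<forall>f\<in>C. generated_trace T \<xi> k \<in> finite_traces (X \<union> Y) \<and>
                   satisfies (generated_trace T \<xi> k) f)))"

end

theory Submission
  imports Defs
begin

text \<open>
  The rank of a state, the first level of \<^const>\<open>WinM_level\<close> that contains it, drops with every
  move of an extracted transducer, whatever the input is. So every play terminates, necessarily in
  level 0. Since the product arena runs all automata in parallel along the generated trace, each
  automaton of a property in \<open>C\<close> accepts this trace.
\<close>

section \<open>Levels of the winning relation and ranks of states\<close>

lemma WinM_level_mono:
  assumes "i \<le> j"
  shows "WinM_level X Y n phi G i \<subseteq> WinM_level X Y n phi G j"
  using assms by (induction rule: dec_induct) auto

lemma WinM_level_states:
  "(s, C) \<in> WinM_level X Y n phi G i \<Longrightarrow> s \<in> states (product_arena X Y n G)"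
  by (induction i) (auto simp: PreMC_def)

lemma finite_restrict_WinM:
  assumes "\<forall>i\<in>{1..n}. finite (states (G i))"
  shows "finite (restrict_to (WinM X Y n phi G) C)"
proof (rule finite_subset)
  show "restrict_to (WinM X Y n phi G) C \<subseteq> states (product_arena X Y n G)"
    by (auto simp: restrict_to_def WinM_def simp del: WinM_level.simps intro: WinM_level_states)
  show "finite (states (product_arena X Y n G))"
    unfolding product_arena_def using assms by (auto intro!: finite_PiE)
qed

text \<open>The least level containing the pair is not 0, hence a successor \<open>Suc j\<close>.
  The bound \<open>j < i\<close> lets later arguments work with any level known to contain the state
  instead of its exact rank.\<close>

lemma WinM_level_rank:
  assumes "(s, C) \<in> WinM_level X Y n phi G i" "(s, C) \<notin> WinM_level X Y n phi G 0"
  obtains j where "j < i" "(s, C) \<in> WinM_level X Y n phi G (Suc j)"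
    "(s, C) \<notin> WinM_level X Y n phi G j"
proof -
  define m where "m = (LEAST m. (s, C) \<in> WinM_level X Y n phi G m)"
  have m: "(s, C) \<in> WinM_level X Y n phi G m"
    unfolding m_def using assms(1) by (rule LeastI)
  have "m \<noteq> 0" using m assms(2) by (intro notI) (simp only:)
  then obtain j where j: "m = Suc j" using not0_implies_Suc by blast
  have "m \<le> i" unfolding m_def using assms(1) by (rule Least_le)
  moreover have "(s, C) \<notin> WinM_level X Y n phi G j"
    by (rule not_less_Least) (simp add: m_def[symmetric] j)
  ultimately show ?thesis using that[of j] m unfolding j Suc_le_eq by blast
qed

text \<open>By monotonicity a pair can be new at one level only. This pins down the level hidden in
  the choice of a move when a transducer is constructed.\<close>

lemma WinM_level_rank_unique:
  assumes "(s, C) \<in> WinM_level X Y n phi G (Suc i)" "(s, C) \<notin> WinM_level X Y n phi G i"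
    and "(s, C) \<in> WinM_level X Y n phi G (Suc j)" "(s, C) \<notin> WinM_level X Y n phi G j"
  shows "i = j"
proof (rule ccontr)
  assume "i \<noteq> j"
  then have "Suc i \<le> j \<or> Suc j \<le> i" by arith
  then show False
    using assms WinM_level_mono[of "Suc i" j X Y n phi G] WinM_level_mono[of "Suc j" i X Y n phi G]
    by blast
qed

section \<open>Existence of an extracted transducer\<close>

lemma extracted_transducer_exists:
  assumes fin: "\<forall>i\<in>{1..n}. finite (states (G i))"
    and init: "(init (product_arena X Y n G), C) \<in> WinM X Y n phi G"
  shows "\<exists>T. extracted_transducer X Y n phi G C T"
proof -
  let ?L = "\<lambda>i. restrict_to (WinM_level X Y n phi G i) C"
  let ?W = "restrict_to (WinM X Y n phi G) C"
  let ?\<delta> = "delta (product_arena X Y n G)"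
  define good where "good s i U \<longleftrightarrow> U \<in> Pow Y \<and> (\<forall>V\<in>Pow X. ?\<delta> s (U \<union> V) \<in> ?L i)" for s i U
  \<comment> \<open>The output may depend on the state alone, so the level is quantified inside the
    choice. Uniqueness of the rank makes the chosen move good for the actual rank.\<close>
  define move where
    "move s = (SOME U. \<exists>i. s \<in> ?L (Suc i) - ?L i \<and> good s i U)" for s
  have move: "good s i (move s)" if fresh: "s \<in> ?L (Suc i) - ?L i" for s i
  proof -
    \<comment> \<open>A state new at level \<open>Suc i\<close> can only come from the
      \<open>PreMC\<close> part of the union.\<close>
    have "(s, C) \<in> PreMC X Y n phi G (WinM_level X Y n phi G i)"
      using fresh by (auto simp: restrict_to_def)
    then have "\<exists>U. good s i U" by (auto simp: PreMC_def good_def restrict_to_def)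
    then have "\<exists>U. \<exists>i. s \<in> ?L (Suc i) - ?L i \<and> good s i U" using fresh by blast
    then have "\<exists>j. s \<in> ?L (Suc j) - ?L j \<and> good s j (move s)"
      unfolding move_def by (rule someI_ex)
    then show ?thesis
      using fresh WinM_level_rank_unique[of s C X Y n phi G] by (auto simp: restrict_to_def)
  qed
  define out where "out s = (if s \<in> ?L 0 then Done else Act (move s))" for s
  \<comment> \<open>Where \<open>out s\<close> is \<open>Done\<close>, the value
    \<open>act (out s)\<close> is unspecified. This is harmless, as \<open>t_next\<close> is
    constrained at the other states only.\<close>
  define T where "T = \<lparr> t_alphabet = Pow (X \<union> Y), t_states = ?W,
    t_init = init (product_arena X Y n G), t_next = (\<lambda>s V. ?\<delta> s (act (out s) \<union> V)), t_out = out \<rparr>"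
  have L0: "s \<notin> ?L 0" if "s \<notin> ?L i" for s i
    using that WinM_level_mono[of 0 i X Y n phi G] by (auto simp: restrict_to_def)
  \<comment> \<open>Closure of the state set under transitions: a good move leads into a lower
    level, which is part of the union \<open>WinM\<close>.\<close>
  have step: "move s \<in> Pow Y \<and> (\<forall>V\<in>Pow X. ?\<delta> s (move s \<union> V) \<in> ?W)"
    if s: "s \<in> ?W" "s \<notin> ?L 0" for s
  proof -
    obtain N where "(s, C) \<in> WinM_level X Y n phi G N" "(s, C) \<notin> WinM_level X Y n phi G 0"
      using s unfolding restrict_to_def WinM_def by blast
    then obtain i where "s \<in> ?L (Suc i) - ?L i"
      unfolding restrict_to_def by (rule WinM_level_rank) blast
    then have "good s i (move s)" by (rule move)
    then show ?thesis by (auto simp: good_def restrict_to_def WinM_def)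
  qed
  have "is_transducer X Y T"
    unfolding is_transducer_def
    using finite_restrict_WinM[OF fin] init step
    by (auto simp: T_def out_def restrict_to_def)
  moreover have "\<exists>U\<in>Pow Y. t_out T s = Act U \<and> (\<forall>V\<in>Pow X. ?\<delta> s (U \<union> V) \<in> ?L (i - 1))"
    if "i > 0" "s \<in> ?L i - ?L (i - 1)" for i s
    using that move[of s "i - 1"] L0[of s "i - 1"] by (auto simp: T_def out_def good_def)
  ultimately have "extracted_transducer X Y n phi G C T"
    unfolding extracted_transducer_def
    by (simp add: T_def out_def del: WinM_level.simps)
  then show ?thesis ..
qed

section \<open>Plays of an arbitrary extracted transducer\<close>

lemma extracted_transducerD:
  assumes "extracted_transducer X Y n phi G C T"
  shows "t_init T \<in> t_states T"
    and "t_init T = init (product_arena X Y n G)"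
    and "s \<in> t_states T \<longleftrightarrow> (\<exists>i. (s, C) \<in> WinM_level X Y n phi G i)"
    and "(s, C) \<in> WinM_level X Y n phi G 0 \<Longrightarrow> t_out T s = Done"
    and "(s, C) \<in> WinM_level X Y n phi G (Suc i) \<Longrightarrow> (s, C) \<notin> WinM_level X Y n phi G i \<Longrightarrow>
      \<exists>U\<in>Pow Y. t_out T s = Act U \<and>
        (\<forall>V\<in>Pow X. (delta (product_arena X Y n G) s (U \<union> V), C) \<in> WinM_level X Y n phi G i)"
    and "s \<in> t_states T \<Longrightarrow> t_out T s \<noteq> Done \<Longrightarrow> V \<in> Pow X \<Longrightarrow>
      t_next T s V = delta (product_arena X Y n G) s (act (t_out T s) \<union> V)"
proof -
  note T = assms[unfolded extracted_transducer_def is_transducer_def restrict_to_def]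
  show "t_init T \<in> t_states T" "t_init T = init (product_arena X Y n G)" using T by blast+
  have "t_states T = {s. (s, C) \<in> WinM X Y n phi G}" using T by blast
  then show "s \<in> t_states T \<longleftrightarrow> (\<exists>i. (s, C) \<in> WinM_level X Y n phi G i)"
    by (simp add: WinM_def)
  show "(s, C) \<in> WinM_level X Y n phi G 0 \<Longrightarrow> t_out T s = Done" using T by blast
  have "\<forall>i>0. \<forall>s\<in>{s. (s, C) \<in> WinM_level X Y n phi G i} - {s. (s, C) \<in> WinM_level X Y n phi G (i - 1)}.
      \<exists>U\<in>Pow Y. t_out T s = Act U \<and> (\<forall>V\<in>Pow X. delta (product_arena X Y n G) s (U \<union> V)
        \<in> {s. (s, C) \<in> WinM_level X Y n phi G (i - 1)})"
    using T by blast
  from this[rule_format, of "Suc i" s]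
  show "(s, C) \<in> WinM_level X Y n phi G (Suc i) \<Longrightarrow> (s, C) \<notin> WinM_level X Y n phi G i \<Longrightarrow>
      \<exists>U\<in>Pow Y. t_out T s = Act U \<and>
        (\<forall>V\<in>Pow X. (delta (product_arena X Y n G) s (U \<union> V), C) \<in> WinM_level X Y n phi G i)"
    by (simp del: WinM_level.simps)
  show "s \<in> t_states T \<Longrightarrow> t_out T s \<noteq> Done \<Longrightarrow> V \<in> Pow X \<Longrightarrow>
      t_next T s V = delta (product_arena X Y n G) s (act (t_out T s) \<union> V)"
    using T by blast
qed

text \<open>Here \<open>i\<close> is any level containing \<open>s\<close>, not necessarily its
  rank. An output other than \<open>Done\<close> excludes level 0, so the rank is some
  \<open>Suc j\<close> with \<open>j < i\<close>; the successor lies in level \<open>j\<close>, and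
  monotonicity lifts this to \<open>i - 1\<close>.\<close>

lemma extracted_transducer_step:
  assumes T: "extracted_transducer X Y n phi G C T"
    and s: "(s, C) \<in> WinM_level X Y n phi G i" and out: "t_out T s \<noteq> Done" and V: "V \<in> Pow X"
  shows "act (t_out T s) \<in> Pow Y"
    and "t_next T s V = delta (product_arena X Y n G) s (act (t_out T s) \<union> V)"
    and "(t_next T s V, C) \<in> WinM_level X Y n phi G (i - 1)"
proof -
  have sT: "s \<in> t_states T"
    using extracted_transducerD(3)[OF T] s by blast
  then show nxt: "t_next T s V = delta (product_arena X Y n G) s (act (t_out T s) \<union> V)"
    using extracted_transducerD(6)[OF T] out V by blast
  have "(s, C) \<notin> WinM_level X Y n phi G 0"
    using extracted_transducerD(4)[OF T] out by blast
  then obtain j where j: "j < i" "(s, C) \<in> WinM_level X Y n phi G (Suc j)"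
    "(s, C) \<notin> WinM_level X Y n phi G j"
    using s WinM_level_rank by metis
  obtain U where U: "U \<in> Pow Y" "t_out T s = Act U"
    "\<forall>V\<in>Pow X. (delta (product_arena X Y n G) s (U \<union> V), C) \<in> WinM_level X Y n phi G j"
    using extracted_transducerD(5)[OF T j(2,3)] by blast
  then show "act (t_out T s) \<in> Pow Y" by simp
  have "(t_next T s V, C) \<in> WinM_level X Y n phi G j" using nxt U V by simp
  then show "(t_next T s V, C) \<in> WinM_level X Y n phi G (i - 1)"
    using WinM_level_mono[of j "i - 1" X Y n phi G] j(1) by (simp add: subset_eq)
qed

text \<open>Each step lowers the level bound by one. Truncated subtraction is safe:
  \<open>t > N\<close> would put the play in level 0 at time \<open>N\<close>, where the output is
  \<open>Done\<close>, against the hypothesis.\<close>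

lemma play_in_WinM_level:
  assumes T: "extracted_transducer X Y n phi G C T" and \<xi>: "\<forall>t. \<xi> t \<in> Pow X"
    and init: "(t_init T, C) \<in> WinM_level X Y n phi G N"
    and "\<And>u. u < t \<Longrightarrow> t_out T (play T \<xi> u) \<noteq> Done"
  shows "(play T \<xi> t, C) \<in> WinM_level X Y n phi G (N - t)"
  using assms(4)
proof (induction t)
  case (Suc t)
  have "(play T \<xi> t, C) \<in> WinM_level X Y n phi G (N - t)"
    by (rule Suc.IH) (rule Suc.prems[OF less_SucI])
  then have "(t_next T (play T \<xi> t) (\<xi> t), C) \<in> WinM_level X Y n phi G (N - t - 1)"
    by (rule extracted_transducer_step(3)[OF T _ Suc.prems[OF lessI] spec[OF \<xi>]])
  then show ?case by simp
qed (simp add: init)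

lemma extracted_transducer_terminates:
  assumes T: "extracted_transducer X Y n phi G C T" and \<xi>: "\<forall>t. \<xi> t \<in> Pow X"
    and init: "(t_init T, C) \<in> WinM_level X Y n phi G N"
  obtains k where "terminates_at T \<xi> k"
proof -
  have "\<exists>k. t_out T (play T \<xi> k) = Done"
  proof (rule ccontr)
    assume never: "\<nexists>k. t_out T (play T \<xi> k) = Done"
    \<comment> \<open>After \<open>N\<close> steps without \<open>Done\<close> the level bound is
      used up, and level 0 forces \<open>Done\<close>.\<close>
    then have "(play T \<xi> N, C) \<in> WinM_level X Y n phi G (N - N)"
      by (intro play_in_WinM_level[OF T \<xi> init]) blast
    then have "t_out T (play T \<xi> N) = Done"
      unfolding diff_self_eq_0 by (rule extracted_transducerD(4)[OF T])
    then show False using never by blast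
  qed
  then have "terminates_at T \<xi> (LEAST k. t_out T (play T \<xi> k) = Done)"
    unfolding terminates_at_def
    by (intro conjI allI impI) (rule LeastI_ex, assumption, rule not_less_Least)
  then show ?thesis ..
qed

text \<open>The converse of the clause for level 0: at positive rank the output is forced to be some
  \<open>Act U\<close>, so \<open>Done\<close> occurs in level 0 only.\<close>

lemma extracted_transducer_Done:
  assumes T: "extracted_transducer X Y n phi G C T"
    and s: "(s, C) \<in> WinM_level X Y n phi G i" and out: "t_out T s = Done"
  shows "state_models n phi G s C"
proof (rule ccontr)
  assume "\<not> state_models n phi G s C"
  then have "(s, C) \<notin> WinM_level X Y n phi G 0" by simp
  with s obtain j where j: "(s, C) \<in> WinM_level X Y n phi G (Suc j)"
    "(s, C) \<notin> WinM_level X Y n phi G j"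
    by (rule WinM_level_rank)
  have "\<exists>U\<in>Pow Y. t_out T s = Act U" using extracted_transducerD(5)[OF T j] by blast
  then show False using out by auto
qed

text \<open>Component \<open>i\<close> of the product reads the same letters as \<open>G i\<close>.
  The level \<open>N\<close> keeps the play inside the winning region, where the outputs, and hence
  the letters, are known to be legal.\<close>

lemma generated_trace_run:
  assumes T: "extracted_transducer X Y n phi G C T" and \<xi>: "\<forall>t. \<xi> t \<in> Pow X"
    and init: "(t_init T, C) \<in> WinM_level X Y n phi G N"
    and "\<And>u. u < k \<Longrightarrow> t_out T (play T \<xi> u) \<noteq> Done" and i: "i \<in> {1..n}"
  shows "generated_trace T \<xi> k \<in> lists (Pow (X \<union> Y)) \<and>
    foldl (delta (G i)) (init (G i)) (generated_trace T \<xi> k) = play T \<xi> k i"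
  using assms(4)
proof (induction k)
  case 0
  show ?case using extracted_transducerD(2)[OF T] i by (simp add: generated_trace_def product_arena_def)
next
  case (Suc k)
  let ?s = "play T \<xi> k"
  have "(?s, C) \<in> WinM_level X Y n phi G (N - k)"
    using play_in_WinM_level[OF T \<xi> init] Suc.prems by simp
  note step = extracted_transducer_step[OF T this Suc.prems[OF lessI] \<xi>[rule_format, of k]]
  have "act (t_out T ?s) \<union> \<xi> k \<in> Pow (X \<union> Y)" using step(1) \<xi>[rule_format, of k] by auto
  moreover have "play T \<xi> (Suc k) i = delta (G i) (?s i) (act (t_out T ?s) \<union> \<xi> k)"
    using step(2) i by (simp add: product_arena_def)
  ultimately show ?case using Suc by (simp add: generated_trace_def)
qed

lemma extracted_transducer_winning:
  assumes lang: "\<forall>i\<in>{1..n}. alphabet (G i) = Pow (X \<union> Y) \<and>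
      language (G i) = {\<rho> \<in> finite_traces (X \<union> Y). satisfies \<rho> (phi i)}"
    and C: "C \<subseteq> phi ` {1..n}"
    and T: "extracted_transducer X Y n phi G C T"
  shows "implements_winning_strategy X Y n phi G C T"
  unfolding implements_winning_strategy_def
proof (intro allI impI)
  fix \<xi> :: "nat \<Rightarrow> 'a set"
  assume \<xi>: "\<forall>t. \<xi> t \<in> Pow X"
  obtain N where init: "(t_init T, C) \<in> WinM_level X Y n phi G N"
    using extracted_transducerD(1,3)[OF T] by blast
  obtain k where k: "terminates_at T \<xi> k"
    by (rule extracted_transducer_terminates[OF T \<xi> init])
  then have notDone: "\<And>t. t < k \<Longrightarrow> t_out T (play T \<xi> t) \<noteq> Done"
    and Done: "t_out T (play T \<xi> k) = Done"
    by (auto simp: terminates_at_def)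
  have level: "(play T \<xi> t, C) \<in> WinM_level X Y n phi G (N - t)" if "t \<le> k" for t
    using play_in_WinM_level[OF T \<xi> init] notDone that by simp
  have models: "state_models n phi G (play T \<xi> k) C"
    using extracted_transducer_Done[OF T level Done] by simp
  have "generated_trace T \<xi> k \<in> finite_traces (X \<union> Y) \<and> satisfies (generated_trace T \<xi> k) f"
    if "f \<in> C" for f
  proof -
    \<comment> \<open>\<open>phi\<close> may repeat a formula; any index of \<open>f\<close> serves,
      since \<open>state_models\<close> demands acceptance at all of them.\<close>
    obtain i where i: "i \<in> {1..n}" "f = phi i" using C \<open>f \<in> C\<close> by blast
    have "play T \<xi> k i \<in> final (G i)" using models i \<open>f \<in> C\<close> by (simp add: state_models_def)
    \<comment> \<open>The language contains only nonempty words, so acceptance also rules out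
      \<open>k = 0\<close> here. For empty \<open>C\<close> the trace is empty, but then no
      \<open>f\<close> has to be considered.\<close>
    then have "generated_trace T \<xi> k \<in> language (G i)"
      using generated_trace_run[OF T \<xi> init notDone i(1)] lang i(1) by (simp add: language_def)
    then show ?thesis using lang i by simp
  qed
  moreover have "play T \<xi> t \<in> t_states T" if "t \<le> k" for t
    using level[OF that] extracted_transducerD(3)[OF T] by blast
  ultimately show "\<exists>k. terminates_at T \<xi> k \<and>
            (\<forall>t\<le>k. play T \<xi> t \<in> t_states T) \<and>
            play T \<xi> k \<in> states (product_arena X Y n G) \<and>
            state_models n phi G (play T \<xi> k) C \<and>
            (\<forall>f\<in>C. generated_trace T \<xi> k \<in> finite_traces (X \<union> Y) \<and>
                   satisfies (generated_trace T \<xi> k) f)"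
    using k models WinM_level_states[OF level[OF order_refl]] by (intro exI[of _ k]) simp
qed

theorem theorem2:
  fixes X Y :: "'a set" and n :: nat and phi :: "nat \<Rightarrow> 'a ltlf"
    and G :: "nat \<Rightarrow> ('q, 'a set) dfa" and C :: "'a ltlf set"
  assumes "finite (X \<union> Y)" and "X \<inter> Y = {}"
    and "\<forall>i\<in>{1..n}. atoms (phi i) \<subseteq> X \<union> Y"
    and "\<forall>i\<in>{1..n}. is_dfa (G i) \<and> alphabet (G i) = Pow (X \<union> Y) \<and>
           language (G i) = {\<rho> \<in> finite_traces (X \<union> Y). satisfies \<rho> (phi i)}"
    and "C \<subseteq> phi ` {1..n}"
    and "(init (product_arena X Y n G), C) \<in> WinM X Y n phi G"
  shows "(\<exists>T. extracted_transducer X Y n phi G C T) \<and>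
         (\<forall>T. extracted_transducer X Y n phi G C T \<longrightarrow> implements_winning_strategy X Y n phi G C T)"
proof
  have "\<forall>i\<in>{1..n}. finite (states (G i))" using assms(4) by (simp add: is_dfa_def)
  then show "\<exists>T. extracted_transducer X Y n phi G C T"
    using assms(6) by (rule extracted_transducer_exists)
  show "\<forall>T. extracted_transducer X Y n phi G C T \<longrightarrow> implements_winning_strategy X Y n phi G C T"
    by (intro allI impI extracted_transducer_winning[OF _ assms(5)]) (simp add: assms(4))
qed

end
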